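(* There exist infinitely many positive integers $n$ such that for every integer $\ell$ with $3\leq \ell\leq \frac{n-1}{12\log n}+2$ we have $$M_{\mathcal{F}_{\ell}}(n)\geq 2^{n-2}.$$ In particular, this holds whenever $n\geq 64$ and $n=p$ or $n=2p-1$ for some odd prime $p$.
   Context: Logarithms are base 2. For graphs $G,G'$ on the same vertex set $[n]=\{1,\dots,n\}$, their symmetric difference $G\oplus G'$ is the graph on $[n]$ whose edge set consists of all edges belonging to exactly one of $G,G'$. For a class $\mathcal{F}$ of graphs, a family $\mathcal{G}$ of graphs on vertex set $[n]$ is $\mathcal{F}$-good if $G\oplus G'\in\mathcal{F}$ for every pair of distinct $G,G'\in\mathcal{G}$; $M_{\mathcal{F}}(n)$ denotes the maximum possible size of an $\mathcal{F}$-good family of graphs on $[n]$. $\mathcal{F}_{\ell}$ denotes the class of graphs containing a spanning tree with exactly $\ell$ leaves. *)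

theory Defs
  imports Complex_Main "HOL-Computational_Algebra.Primes"
begin

definition all_edges :: "nat \<Rightarrow> nat set set" where
  "all_edges n = {e. e \<subseteq> {1..n} \<and> card e = 2}"

definition is_graph :: "nat \<Rightarrow> nat set set \<Rightarrow> bool" where
  "is_graph n E \<longleftrightarrow> E \<subseteq> all_edges n"

definition sym_diff :: "nat set set \<Rightarrow> nat set set \<Rightarrow> nat set set" where
  "sym_diff E E' = (E - E') \<union> (E' - E)"

definition adj :: "nat set set \<Rightarrow> nat \<Rightarrow> nat \<Rightarrow> bool" where
  "adj E u v \<longleftrightarrow> {u, v} \<in> E"

definition connected_on :: "nat \<Rightarrow> nat set set \<Rightarrow> bool" where
  "connected_on n E \<longleftrightarrow> (\<forall>u\<in>{1..n}. \<forall>v\<in>{1..n}. (adj E)\<^sup>*\<^sup>* u v)"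

definition is_spanning_tree_on :: "nat \<Rightarrow> nat set set \<Rightarrow> bool" where
  "is_spanning_tree_on n T \<longleftrightarrow> is_graph n T \<and> connected_on n T \<and> card T = n - 1"

definition degree :: "nat set set \<Rightarrow> nat \<Rightarrow> nat" where
  "degree E v = card {e \<in> E. v \<in> e}"

definition leaves :: "nat \<Rightarrow> nat set set \<Rightarrow> nat set" where
  "leaves n T = {v \<in> {1..n}. degree T v = 1}"

definition F_leaves :: "nat \<Rightarrow> nat \<Rightarrow> nat set set \<Rightarrow> bool" where
  "F_leaves l n E \<longleftrightarrow> (\<exists>T \<subseteq> E. is_spanning_tree_on n T \<and> card (leaves n T) = l)"

text \<open>A class of graphs is a predicate F n E (E a graph on [n]).\<close>
definition good_family :: "(nat \<Rightarrow> nat set set \<Rightarrow> bool) \<Rightarrow> nat \<Rightarrow> nat set set set \<Rightarrow> bool" where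
  "good_family F n \<G> \<longleftrightarrow> (\<forall>E\<in>\<G>. is_graph n E) \<and>
     (\<forall>E\<in>\<G>. \<forall>E'\<in>\<G>. E \<noteq> E' \<longrightarrow> F n (sym_diff E E'))"

definition M_F :: "(nat \<Rightarrow> nat set set \<Rightarrow> bool) \<Rightarrow> nat \<Rightarrow> nat" where
  "M_F F n = Max {card \<G> | \<G>. good_family F n \<G>}"

definition good_n :: "nat \<Rightarrow> bool" where
  "good_n n \<longleftrightarrow> (\<forall>l::nat. 3 \<le> l \<and> real l \<le> (real n - 1) / (12 * log 2 (real n)) + 2
        \<longrightarrow> M_F (F_leaves l) n \<ge> 2 ^ (n - 2))"

end

theory Submission
  imports Defs "HOL-Number_Theory.Cong"
begin

text \<open>
  Deleting a vertex from a perfect 1-factorization of the complete graph on \<open>n + 1\<close> vertices gives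
  \<open>n\<close> disjoint matchings on \<open>{1..n}\<close>, any two of which form a Hamiltonian path. Such
  factorizations are classical when \<open>n\<close> is an odd prime \<open>p\<close> or \<open>2 * p - 1\<close>. Fix one matching
  \<open>M\<close> and let \<open>A\<close> range over the \<open>2 ^ (n - 2)\<close> even subsets of the other ones. The graph of
  \<open>A\<close> is the union of the members of \<open>A\<close> and the sum modulo 2, over the members of \<open>A\<close>,
  of certain subsets of \<open>M\<close>; so the symmetric difference of two graphs of the family is again the
  graph of a nonempty even set.

  Such a graph contains a Hamiltonian path and many disjoint chords: another full matching if
  \<open>A\<close> has more than two members, and otherwise a part of \<open>M\<close>, provided that the subsets of \<open>M\<close>
  are pairwise far apart. To this end the edges of \<open>M\<close> are numbered and the subset for the \<open>i\<close>-th
  matching is read off from the binary digits of \<open>i\<close>, each repeated often.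

  Orient the Hamiltonian path and let the parent of a vertex be its predecessor. Making the
  smaller end of a chord the parent of its larger end turns the predecessor of the larger end
  into a leaf, unless another chosen chord starts there. Hence \<open>k\<close> suitable chords out of
  \<open>3 * k + 1\<close> yield a spanning tree with exactly \<open>k + 2\<close> leaves.
\<close>

section \<open>Even subsets and a lower bound for \<open>M_F\<close>\<close>

lemma even_card_sym_diff:
  assumes "finite A" "finite B"
  shows "even (card ((A - B) \<union> (B - A))) \<longleftrightarrow> (even (card A) \<longleftrightarrow> even (card B))"
proof -
  have "card ((A - B) \<union> (B - A)) = card (A - B) + card (B - A)"
    using assms by (intro card_Un_disjoint) auto
  moreover have "card A = card (A - B) + card (A \<inter> B)"
    using assms by (metis Int_Diff_Un Int_Diff_disjoint card_Un_disjoint finite_Diff finite_Int add.commute)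
  moreover have "card B = card (B - A) + card (A \<inter> B)"
    using assms by (metis Int_commute Int_Diff_Un Int_Diff_disjoint card_Un_disjoint finite_Diff finite_Int add.commute)
  ultimately show ?thesis by auto
qed

text \<open>Adding \<open>m\<close> to the odd subsets of \<open>{..<m}\<close> makes them even, and
  deleting \<open>m\<close> recovers the original set.\<close>

lemma card_even_subsets_ge:
  "2 ^ m \<le> card {A. A \<subseteq> {..<Suc m} \<and> even (card A)}"
proof -
  let ?g = "\<lambda>B. if even (card B) then B else insert m B"
  have "card (Pow {..<m}) \<le> card {A. A \<subseteq> {..<Suc m} \<and> even (card A)}"
  proof (rule card_inj_on_le)
    show "inj_on ?g (Pow {..<m})"
      by (rule inj_on_inverseI[where g = "\<lambda>A. A - {m}"]) auto
    show "?g ` Pow {..<m} \<subseteq> {A. A \<subseteq> {..<Suc m} \<and> even (card A)}"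
    proof clarify
      fix B assume B: "B \<subseteq> {..<m}"
      then have "finite B" "m \<notin> B" using finite_subset by auto
      then show "?g B \<subseteq> {..<Suc m} \<and> even (card (?g B))"
        using B by auto
    qed
  qed auto
  then show ?thesis by (simp add: card_Pow)
qed

lemma finite_all_edges: "finite (all_edges n)"
  by (rule finite_subset[of _ "Pow {1..n}"]) (auto simp: all_edges_def)

text \<open>Equal graphs have an empty symmetric difference, which \<open>empty\<close> excludes, so
  distinct indices give distinct graphs.\<close>

lemma M_F_ge_card:
  assumes graph: "\<And>A. A \<in> X \<Longrightarrow> is_graph n (\<Gamma> A)"
    and diff: "\<And>A B. A \<in> X \<Longrightarrow> B \<in> X \<Longrightarrow> A \<noteq> B \<Longrightarrow> F n (sym_diff (\<Gamma> A) (\<Gamma> B))"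
    and empty: "\<not> F n {}"
  shows "card X \<le> M_F F n"
proof -
  have "inj_on \<Gamma> X"
  proof (rule inj_onI, rule ccontr)
    fix A B assume "A \<in> X" "B \<in> X" "\<Gamma> A = \<Gamma> B" "A \<noteq> B"
    with diff[of A B] empty show False by (simp add: sym_diff_def)
  qed
  then have "card (\<Gamma> ` X) = card X" by (rule card_image)
  moreover have "good_family F n (\<Gamma> ` X)"
    unfolding good_family_def using graph diff by auto
  ultimately have mem: "card X \<in> {card \<G> | \<G>. good_family F n \<G>}" by force
  have "{\<G>. good_family F n \<G>} \<subseteq> Pow (Pow (all_edges n))"
    by (auto simp: good_family_def is_graph_def)
  then have "finite {\<G>. good_family F n \<G>}"
    by (rule finite_subset) (simp add: finite_all_edges)
  then have "finite (card ` {\<G>. good_family F n \<G>})" by (rule finite_imageI)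
  also have "card ` {\<G>. good_family F n \<G>} = {card \<G> | \<G>. good_family F n \<G>}" by auto
  finally show ?thesis unfolding M_F_def using mem by (intro Max_ge)
qed

section \<open>Spanning trees from a Hamiltonian path and chords\<close>

text \<open>Greedy choice: as starts and ends are pairwise distinct, a chosen chord
  \<open>(a, b)\<close> conflicts with at most one chord starting at \<open>b - 1\<close> and at
  most one ending at \<open>a + 1\<close>. So each choice uses up at most three chords. The gap
  \<open>a + 2 \<le> b\<close> keeps a chord from conflicting with itself.\<close>

lemma independent_chords:
  fixes D :: "(nat \<times> nat) set"
  assumes "finite D" "inj_on fst D" "inj_on snd D" "3 * k \<le> card D"
    and "\<And>a b. (a, b) \<in> D \<Longrightarrow> a + 2 \<le> b"
  obtains K where "K \<subseteq> D" "card K = k" "\<And>a b a' b'. (a, b) \<in> K \<Longrightarrow> (a', b') \<in> K \<Longrightarrow> a' + 1 \<noteq> b"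
proof -
  have "\<exists>K \<subseteq> D. card K = k \<and> (\<forall>(a, b) \<in> K. \<forall>(a', b') \<in> K. a' + 1 \<noteq> b)"
    using assms
  proof (induction k arbitrary: D)
    case 0
    then show ?case by (intro exI[of _ "{}"]) auto
  next
    case (Suc k)
    then have "D \<noteq> {}" by auto
    then obtain a b where ab: "(a, b) \<in> D" by auto
    define P where "P = {d \<in> D. fst d + 1 = b}"
    define Q where "Q = {d \<in> D. snd d = a + 1}"
    have "card P \<le> 1"
      using Suc.prems(1,2) unfolding P_def One_nat_def card_le_Suc0_iff_eq[OF finite_subset[OF Collect_restrict Suc.prems(1)]]
      by (auto simp: inj_on_def)
    moreover have "card Q \<le> 1"
      using Suc.prems(1,3) unfolding Q_def One_nat_def card_le_Suc0_iff_eq[OF finite_subset[OF Collect_restrict Suc.prems(1)]]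
      by (auto simp: inj_on_def)
    moreover have "card ({(a, b)} \<union> P \<union> Q) \<le> card {(a, b)} + card P + card Q"
      by (meson add_mono card_Un_le le_refl order_trans)
    ultimately have "card ({(a, b)} \<union> P \<union> Q) \<le> 3" by simp
    moreover have "card D - card ({(a, b)} \<union> P \<union> Q) \<le> card (D - ({(a, b)} \<union> P \<union> Q))"
      using Suc.prems(1) by (intro diff_card_le_card_Diff) (auto simp: P_def Q_def)
    ultimately have "3 * k \<le> card (D - ({(a, b)} \<union> P \<union> Q))"
      using Suc.prems(4) by simp
    with Suc.IH[of "D - ({(a, b)} \<union> P \<union> Q)"] Suc.prems obtain K where K:
      "K \<subseteq> D - ({(a, b)} \<union> P \<union> Q)" "card K = k"
      "\<forall>(a, b) \<in> K. \<forall>(a', b') \<in> K. a' + 1 \<noteq> b"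
      by (metis (no_types, lifting) DiffD1 finite_Diff inj_on_diff)
    have fin: "finite K" using K(1) Suc.prems(1) by (meson finite_Diff finite_subset)
    show ?case
    proof (intro exI[of _ "insert (a, b) K"] conjI)
      show "insert (a, b) K \<subseteq> D" using K(1) ab by auto
      show "card (insert (a, b) K) = Suc k" using K(1,2) fin by (subst card_insert_disjoint) auto
      have "a + 1 \<noteq> b" using Suc.prems(5)[OF ab] by simp
      then show "\<forall>(c, d) \<in> insert (a, b) K. \<forall>(c', d') \<in> insert (a, b) K. c' + 1 \<noteq> d"
        using K(1,3) by (force simp: P_def Q_def)
    qed
  qed
  then show ?thesis using that by fast
qed

text \<open>Chords are pairs of positions on the path. The leaves of the tree sit at the two ends of
  the path and at the positions \<open>b - 1\<close> for the chord ends \<open>b\<close>. The bound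
  \<open>1 \<le> a\<close> keeps position 0 a leaf, and \<open>indep\<close> keeps chords from
  starting at such a \<open>b - 1\<close>.\<close>

lemma F_leaves_path_chords:
  assumes x: "bij_betw x {..<n} {1..n}" and n: "2 \<le> n"
    and path: "\<And>i. Suc i < n \<Longrightarrow> {x i, x (Suc i)} \<in> E"
    and K: "finite K" "inj_on snd K"
      "\<And>a b. (a, b) \<in> K \<Longrightarrow> 1 \<le> a \<and> a + 2 \<le> b \<and> b < n \<and> {x a, x b} \<in> E"
    and indep: "\<And>a b a' b'. (a, b) \<in> K \<Longrightarrow> (a', b') \<in> K \<Longrightarrow> a' + 1 \<noteq> b"
  shows "F_leaves (card K + 2) n E"
proof -
  \<comment> \<open>Injectivity of \<open>snd\<close> on \<open>K\<close> makes the described chord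
    start unique.\<close>
  define par where "par b = (if \<exists>a. (a, b) \<in> K then THE a. (a, b) \<in> K else b - 1)" for b
  have parK: "par b = a" if "(a, b) \<in> K" for a b
  proof -
    have "(THE a. (a, b) \<in> K) = a"
      using that K(2) by (intro the_equality) (auto dest: inj_onD[where x = "(_, b)" and y = "(a, b)"])
    then show ?thesis using that by (auto simp: par_def)
  qed
  have par_cases: "par b = b - 1 \<and> b \<notin> snd ` K \<or> (par b, b) \<in> K" for b
  proof (cases "\<exists>a. (a, b) \<in> K")
    case True then show ?thesis using parK by auto
  next
    case False then show ?thesis by (force simp: par_def)
  qed
  have par_less: "par b < b" if "1 \<le> b" for b
    using par_cases[of b] K(3)[of "par b" b] that by auto
  define g where "g b = {x (par b), x b}" for b
  have xinj: "x i = x j \<longleftrightarrow> i = j" if "i < n" "j < n" for i j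
    using x that by (auto simp: bij_betw_def inj_on_def)
  have xmem: "x i \<in> {1..n}" if "i < n" for i
    using x that by (auto simp: bij_betw_def)
  have g_inj: "inj_on g {1..<n}"
  proof (rule inj_onI)
    fix b c assume bc: "b \<in> {1..<n}" "c \<in> {1..<n}" "g b = g c"
    then have "par b < b" "par c < c" using par_less by auto
    with bc show "b = c" unfolding g_def doubleton_eq_iff using xinj by auto
  qed
  define T where "T = g ` {1..<n}"
  have "T \<subseteq> E"
  proof -
    have "g b \<in> E" if "b \<in> {1..<n}" for b
      using par_cases[of b] K(3)[of "par b" b] path[of "b - 1"] that by (auto simp: g_def)
    then show ?thesis by (auto simp: T_def)
  qed
  have "is_graph n T"
  proof -
    have "g b \<in> all_edges n" if "b \<in> {1..<n}" for b
      using that xmem[of b] xmem[of "par b"] par_less[of b] xinj[of "par b" b]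
      by (auto simp: g_def all_edges_def card_2_iff)
    then show ?thesis by (auto simp: T_def is_graph_def)
  qed
  have adj_sym: "adj T u v \<longleftrightarrow> adj T v u" for u v by (simp add: adj_def insert_commute)
  have reach: "(adj T)\<^sup>*\<^sup>* (x 0) (x b) \<and> (adj T)\<^sup>*\<^sup>* (x b) (x 0)" if "b < n" for b
    using that
  proof (induction b rule: less_induct)
    case (less b)
    show ?case
    proof (cases "b = 0")
      case False
      then have lt: "par b < b" using par_less by simp
      have "adj T (x (par b)) (x b)" using False less.prems by (auto simp: adj_def T_def g_def)
      with less.IH[OF lt] lt less.prems adj_sym show ?thesis
        by (meson converse_rtranclp_into_rtranclp less_trans rtranclp.rtrancl_into_rtrancl)
    qed auto
  qed
  have "connected_on n T"
    unfolding connected_on_def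
  proof (intro ballI)
    fix u v assume "u \<in> {1..n}" "v \<in> {1..n}"
    then obtain i j where "u = x i" "v = x j" "i < n" "j < n"
      using x by (auto simp: bij_betw_def) (metis (no_types, lifting) atLeastAtMost_iff imageE lessThan_iff)
    then show "(adj T)\<^sup>*\<^sup>* u v" using reach[of i] reach[of j] by auto
  qed
  moreover have "card T = n - 1" using g_inj by (simp add: T_def card_image)
  ultimately have tree: "is_spanning_tree_on n T"
    using \<open>is_graph n T\<close> by (simp add: is_spanning_tree_on_def)

  \<comment> \<open>A tree edge is named by its child, so \<open>inc v\<close> lists the edges at
    position \<open>v\<close>: the one to the parent, absent for \<open>v = 0\<close>, and those to
    the children.\<close>
  define inc where "inc v = {b \<in> {1..<n}. b = v \<or> par b = v}" for v
  have deg: "Defs.degree T (x v) = card (inc v)" if "v < n" for v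
  proof -
    have "{e \<in> T. x v \<in> e} = g ` inc v"
      using that xinj par_less by (force simp: T_def g_def inc_def)
    moreover have "inj_on g (inc v)" using g_inj by (rule inj_on_subset) (auto simp: inc_def)
    ultimately show ?thesis by (simp add: degree_def card_image)
  qed
  define Lv where "Lv = {0, n - 1} \<union> (\<lambda>(a, b). b - 1) ` K"
  have leaf: "card (inc v) = 1 \<longleftrightarrow> v \<in> Lv" if v: "v < n" for v
  proof -
    consider "v = 0" | "v = n - 1" | "0 < v" "v < n - 1" using v by linarith
    then show ?thesis
    proof cases
      case 1
      have "par 1 = 0" using par_less[of 1] by simp
      moreover have "b = 1" if "par b = 0" "b \<ge> 1" for b
        using par_cases[of b] K(3)[of "par b" b] that by auto
      ultimately have "inc v = {1}" using 1 n by (auto simp: inc_def)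
      then show ?thesis using 1 by (simp add: Lv_def)
    next
      case 2
      have "par b \<noteq> n - 1" if "b \<in> {1..<n}" for b using par_less[of b] that by auto
      then have "inc v = {n - 1}" using 2 n by (auto simp: inc_def)
      then show ?thesis using 2 by (simp add: Lv_def)
    next
      \<comment> \<open>An inner position is a leaf iff it has no child. The path child
        \<open>v + 1\<close> is lost exactly when a chord ends there, and then \<open>indep\<close>
        excludes any other child.\<close>
      case 3
      have vin: "v \<in> inc v" using 3 by (auto simp: inc_def)
      show ?thesis
      proof (cases "v + 1 \<in> snd ` K")
        case True
        then obtain a where a: "(a, v + 1) \<in> K" by auto
        have "par b \<noteq> v" if "b \<in> {1..<n}" for b
        proof
          assume pb: "par b = v"
          show False
          proof (cases "b \<in> snd ` K")
            case True
            then have "(v, b) \<in> K" using pb par_cases[of b] by auto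
            then show False using indep[OF a] by blast
          next
            case False
            then have "b = v + 1" using par_cases[of b] pb that by force
            then show False using False \<open>v + 1 \<in> snd ` K\<close> by simp
          qed
        qed
        then have "inc v = {v}" using vin by (auto simp: inc_def)
        moreover have "v \<in> Lv" using a by (force simp: Lv_def)
        ultimately show ?thesis by simp
      next
        case False
        then have "par (v + 1) = v" using par_cases[of "v + 1"] by force
        then have "v + 1 \<in> inc v" using 3 by (auto simp: inc_def)
        then have "card (inc v) \<noteq> 1" using vin by (auto simp: card_1_singleton_iff)
        moreover have "v \<notin> Lv"
        proof
          assume "v \<in> Lv"
          then obtain a b where "(a, b) \<in> K" "v = b - 1" using 3 by (auto simp: Lv_def)
          then show False using False K(3)[of a b] by force
        qed
        ultimately show ?thesis by simp
      qed
    qed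
  qed
  have Lv_sub: "Lv \<subseteq> {..<n}" using n K(3) by (force simp: Lv_def)
  have "leaves n T = x ` Lv"
  proof -
    have "{1..n} = x ` {..<n}" using x by (simp add: bij_betw_def)
    then have "leaves n T = x ` {v \<in> {..<n}. Defs.degree T (x v) = 1}" by (auto simp: leaves_def)
    also have "{v \<in> {..<n}. Defs.degree T (x v) = 1} = Lv" using deg leaf Lv_sub by auto
    finally show ?thesis .
  qed
  then have "card (leaves n T) = card Lv"
    using x Lv_sub by (metis bij_betw_def card_image inj_on_subset)
  also have "card Lv = card {0, n - 1} + card ((\<lambda>(a, b). b - 1) ` K)"
    unfolding Lv_def
  proof (rule card_Un_disjoint)
    show "{0, n - 1} \<inter> (\<lambda>(a, b). b - 1) ` K = {}" using K(3) by fastforce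
  qed (use K(1) in auto)
  also have "card ((\<lambda>(a, b). b - 1) ` K) = card K"
  proof (rule card_image, rule inj_onI, clarify)
    fix a b a' b' assume k: "(a, b) \<in> K" "(a', b') \<in> K" "b - 1 = b' - 1"
    then have "b = b'" using K(3)[of a b] K(3)[of a' b'] by auto
    then show "a = a' \<and> b = b'" using k parK by blast
  qed
  also have "card {0, n - 1} = 2" using n by simp
  finally have "card (leaves n T) = card K + 2" by simp
  then show ?thesis unfolding F_leaves_def using tree \<open>T \<subseteq> E\<close> by blast
qed

text \<open>The extra 1 in \<open>3 * k + 1\<close> pays for an edge of \<open>R\<close> that may
  meet the start of the path; the other \<open>3 * k\<close> yield \<open>k\<close> independent
  chords. Path edges lie outside \<open>R\<close>, so every chord skips a vertex.\<close>

lemma F_leaves_path_matching: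
  assumes x: "bij_betw x {..<n} {1..n}" and n: "2 \<le> n"
    and path: "\<And>i. Suc i < n \<Longrightarrow> {x i, x (Suc i)} \<in> E - R"
    and R: "R \<subseteq> E" "R \<subseteq> all_edges n" "pairwise disjnt R" and card_R: "3 * k + 1 \<le> card R"
  shows "F_leaves (k + 2) n E"
proof -
  define D where "D = {(a, b). a < b \<and> b < n \<and> {x a, x b} \<in> R}"
  have xinj: "x i = x j \<longleftrightarrow> i = j" if "i < n" "j < n" for i j
    using x that by (auto simp: bij_betw_def inj_on_def)
  have finD: "finite D"
    by (rule finite_subset[of _ "{..<n} \<times> {..<n}"]) (auto simp: D_def)
  have "R \<subseteq> (\<lambda>(a, b). {x a, x b}) ` D"
  proof
    fix e assume e: "e \<in> R"
    then obtain u v where uv: "e = {u, v}" "u \<noteq> v" "u \<in> {1..n}" "v \<in> {1..n}"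
      using R(2) by (auto simp: all_edges_def card_2_iff)
    have ran: "{1..n} = x ` {..<n}" using x by (simp add: bij_betw_def)
    obtain i where i: "u = x i" "i < n" using uv(3) unfolding ran by auto
    obtain j where j: "v = x j" "j < n" using uv(4) unfolding ran by auto
    have "(i, j) \<in> D \<or> (j, i) \<in> D" using e uv(1,2) i j
      by (cases i j rule: linorder_cases) (auto simp: D_def insert_commute)
    then show "e \<in> (\<lambda>(a, b). {x a, x b}) ` D" using uv(1) i(1) j(1) by (auto simp: insert_commute)
  qed
  then have "card R \<le> card D" using finD by (meson surj_card_le)
  have meet: "d = d'" if dd: "d \<in> D" "d' \<in> D" and eq: "fst d = fst d' \<or> snd d = snd d'" for d d'
  proof -
    obtain a b a' b' where ab: "d = (a, b)" "d' = (a', b')" by fastforce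
    have "{x a, x b} = {x a', x b'}"
    proof (rule ccontr)
      assume "{x a, x b} \<noteq> {x a', x b'}"
      then have "disjnt {x a, x b} {x a', x b'}"
        using dd ab R(3) by (intro pairwiseD[of disjnt R]) (auto simp: D_def)
      then show False using eq ab by (auto simp: disjnt_def)
    qed
    then show ?thesis using dd ab xinj by (auto simp: D_def doubleton_eq_iff)
  qed
  define D' where "D' = {d \<in> D. fst d \<noteq> 0}"
  have "d = d'" if "d \<in> D - D'" "d' \<in> D - D'" for d d'
    using that by (intro meet) (auto simp: D'_def)
  then have "card (D - D') \<le> 1" using finD by (simp add: card_le_Suc0_iff_eq)
  then have "3 * k \<le> card D'"
    using card_R \<open>card R \<le> card D\<close> diff_card_le_card_Diff[of "D - D'" D] finD
      double_diff[of D' D D] by (simp add: D'_def)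
  moreover have gap: "a + 2 \<le> b" if "(a, b) \<in> D'" for a b
    using that path[of a] by (cases "b = Suc a") (auto simp: D'_def D_def)
  moreover have "finite D'" using finD by (simp add: D'_def)
  moreover have "inj_on fst D'" by (rule inj_onI, rule meet) (auto simp: D'_def)
  moreover have "inj_on snd D'" by (rule inj_onI, rule meet) (auto simp: D'_def)
  ultimately obtain K where K: "K \<subseteq> D'" "card K = k"
    "\<And>a b a' b'. (a, b) \<in> K \<Longrightarrow> (a', b') \<in> K \<Longrightarrow> a' + 1 \<noteq> b"
    by (metis independent_chords)
  have "F_leaves (card K + 2) n E"
  proof (rule F_leaves_path_chords[OF x n])
    show "finite K" "inj_on snd K"
      using K(1) \<open>finite D'\<close> \<open>inj_on snd D'\<close> by (auto intro: finite_subset inj_on_subset)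
    show "1 \<le> a \<and> a + 2 \<le> b \<and> b < n \<and> {x a, x b} \<in> E" if "(a, b) \<in> K" for a b
      using K(1) that gap[of a b] R(1) by (auto simp: D'_def D_def)
  qed (use path K(3) in auto)
  then show ?thesis using K(2) by simp
qed

section \<open>Perfect 1-factorizations\<close>

text \<open>Apply the two maps alternately from \<open>w\<close>. The first repetition closes a
  cycle at \<open>w\<close>, whose vertex set is invariant under both maps and hence all of
  \<open>V\<close>. Removing \<open>w\<close> leaves the path.\<close>

lemma two_involutions_hamiltonian_path:
  fixes \<sigma> \<tau> :: "'a \<Rightarrow> 'a"
  assumes fin: "finite V" and w: "w \<in> V"
    and \<sigma>: "\<And>x. x \<in> V \<Longrightarrow> \<sigma> x \<in> V \<and> \<sigma> (\<sigma> x) = x \<and> \<sigma> x \<noteq> x"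
    and \<tau>: "\<And>x. x \<in> V \<Longrightarrow> \<tau> x \<in> V \<and> \<tau> (\<tau> x) = x \<and> \<tau> x \<noteq> x"
    and trans: "\<And>S. S \<subseteq> V \<Longrightarrow> w \<in> S \<Longrightarrow> \<sigma> ` S \<subseteq> S \<Longrightarrow> \<tau> ` S \<subseteq> S \<Longrightarrow> S = V"
  shows "\<exists>z. bij_betw z {..<card V - 1} (V - {w}) \<and>
    (\<forall>k. Suc k < card V - 1 \<longrightarrow> z (Suc k) = \<sigma> (z k) \<or> z (Suc k) = \<tau> (z k))"
proof -
  define c where "c = rec_nat w (\<lambda>k x. if even k then \<sigma> x else \<tau> x)"
  have c0: "c 0 = w" and cS: "c (Suc k) = (if even k then \<sigma> (c k) else \<tau> (c k))" for k
    by (auto simp: c_def)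
  have cV: "c k \<in> V" for k by (induction k) (auto simp: c0 cS w \<sigma> \<tau>)
  have prev: "c k = (if even k then \<sigma> (c (Suc k)) else \<tau> (c (Suc k)))" for k
    using cV[of k] by (auto simp: cS \<sigma> \<tau>)
  have neq: "c (Suc k) \<noteq> c k" for k using cV[of k] by (auto simp: cS \<sigma> \<tau>)
  define P where "P = (\<lambda>L. \<exists>j<L. c j = c L)"
  have "\<exists>L. P L"
  proof (rule ccontr)
    assume "\<nexists>L. P L"
    then have "inj c" unfolding P_def inj_def by (metis linorder_neqE_nat)
    then show False using fin cV by (meson finite_subset finite_imageD image_subsetI infinite_UNIV_nat)
  qed
  define L where "L = (LEAST L. P L)"
  have PL: "P L" unfolding L_def using \<open>\<exists>L. P L\<close> by (rule LeastI_ex)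
  have inj: "inj_on c {..<L}"
  proof (rule linorder_inj_onI)
    fix i j assume "i < j" "i \<in> {..<L}" "j \<in> {..<L}"
    then show "c i \<noteq> c j" using not_less_Least[of j P] unfolding L_def P_def by auto
  qed auto
  have injD: "i = k" if "c i = c k" "i < L" "k < L" for i k
    using inj that by (auto dest: inj_onD)
  obtain j where j: "j < L" "c j = c L" using PL P_def by auto
  then obtain M where M: "L = Suc M" using less_imp_Suc_add by blast
  have "j = 0"
  proof (rule ccontr)
    assume "j \<noteq> 0"
    then obtain i where i: "j = Suc i" using not0_implies_Suc by blast
    \<comment> \<open>Compare the steps into \<open>c L\<close> and \<open>c j\<close>. If they use
      the same map, their origins agree, against the minimality of \<open>L\<close>. Otherwise
      \<open>c M\<close> is the successor of \<open>c j\<close>, and \<open>M = Suc j\<close> has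
      the wrong parity.\<close>
    show False
    proof (cases "even M \<longleftrightarrow> even i")
      case True
      then have "c M = c i" using prev[of M] prev[of i] j(2) i M by simp
      then show False using injD[of M i] i j(1) M by simp
    next
      case False
      then have "c M = c (Suc j)" using prev[of M] cS[of j] j(2) i M by simp
      moreover have "j \<noteq> M" using neq[of M] j(2) M by auto
      ultimately have "M = Suc j" using injD[of M "Suc j"] j(1) M by simp
      then show False using False i by simp
    qed
  qed
  then have cL: "c L = w" using j(2) c0 by simp
  have M0: "M \<noteq> 0"
  proof
    assume "M = 0"
    then show False using neq[of 0] cL c0 M by simp
  qed
  \<comment> \<open>The walk returns to \<open>w\<close> by \<open>\<tau>\<close>, which puts
    \<open>\<tau> w\<close> on the cycle; a return by \<open>\<sigma>\<close> would give
    \<open>c M = c 1\<close>.\<close>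
  have oddM: "odd M"
  proof
    assume "even M"
    then have "c M = c 1" using prev[of M] cS[of 0] cL c0 M by simp
    then have "M = 1" using injD[of M 1] M M0 by simp
    with \<open>even M\<close> show False by simp
  qed
  have nbr: "\<sigma> (c k) \<in> c ` {..<L} \<and> \<tau> (c k) \<in> c ` {..<L}" if "k < L" for k
  proof -
    have up: "c (Suc k) \<in> c ` {..<L}"
      using that cL c0 M by (cases "Suc k = L") (auto intro: image_eqI[of _ _ 0])
    have down: "(if even k then \<tau> (c k) else \<sigma> (c k)) \<in> c ` {..<L}"
    proof (cases k)
      case 0
      then have "\<tau> (c k) = c M" using prev[of M] oddM cL c0 M by simp
      then show ?thesis using 0 M by simp
    next
      case (Suc i)
      then have "(if even k then \<tau> (c k) else \<sigma> (c k)) = c i" using prev[of i] by simp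
      then show ?thesis using Suc that by simp
    qed
    show ?thesis using up down cS[of k] by (auto split: if_splits)
  qed
  have CV: "c ` {..<L} = V"
  proof (rule trans)
    show "w \<in> c ` {..<L}" using c0 M by (auto intro: image_eqI[of _ _ 0])
  qed (use cV nbr in auto)
  have cardV: "card V = L" using CV card_image[OF inj] by simp
  have "{..<L} = insert 0 (Suc ` {..<M})" using M lessThan_Suc_eq_insert_0 by simp
  then have "V = insert w ((c \<circ> Suc) ` {..<M})" using CV c0 by (auto simp: image_comp)
  moreover have "w \<notin> (c \<circ> Suc) ` {..<M}"
    using injD[of 0] c0 M by auto
  moreover have "inj_on (c \<circ> Suc) {..<M}"
    using injD M by (auto intro!: inj_onI) (metis Suc_less_eq Suc_inject)
  ultimately have "bij_betw (c \<circ> Suc) {..<card V - 1} (V - {w})"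
    unfolding bij_betw_def using cardV M by auto
  then show ?thesis by (intro exI[of _ "c \<circ> Suc"]) (use cS in auto)
qed

text \<open>Applied to the numbered edges of the reserved matching, this bounds from below how many
  of them read the binary digit \<open>t\<close>.\<close>

lemma card_residue_class_ge:
  assumes "t < d"
  shows "m div d \<le> card {q. q < m \<and> q mod d = t}"
proof -
  have "card {..<m div d} \<le> card {q. q < m \<and> q mod d = t}"
  proof (rule card_inj_on_le)
    show "inj_on (\<lambda>r. r * d + t) {..<m div d}" using assms by (auto intro!: inj_onI)
    show "(\<lambda>r. r * d + t) ` {..<m div d} \<subseteq> {q. q < m \<and> q mod d = t}"
    proof clarsimp
      fix r assume "r < m div d"
      then have "Suc r * d \<le> (m div d) * d" by (intro mult_right_mono) auto
      also have "\<dots> \<le> m" by simp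
      finally show "r * d + t < m \<and> t mod d = t" using assms by simp
    qed
  qed auto
  then show ?thesis by simp
qed

lemma exists_distinguishing_bit:
  fixes i j :: nat
  assumes "i < 2 ^ d" "j < 2 ^ d" "i \<noteq> j"
  obtains t where "t < d" "bit i t \<noteq> bit j t"
proof -
  have "take_bit d i \<noteq> take_bit d j" using assms by (simp add: take_bit_nat_eq_self)
  then show ?thesis using that by (auto simp: bit_eq_iff bit_take_bit_iff)
qed

text \<open>The \<open>i\<close>-th factor is the set of pairs \<open>{x, f i x}\<close>; transitivity says that the union of
  two factors is connected.\<close>

locale perfect_factorization =
  fixes n :: nat and V :: "'a set" and f :: "nat \<Rightarrow> 'a \<Rightarrow> 'a"
  assumes card_V: "card V = Suc n"
    and closed: "i < n \<Longrightarrow> x \<in> V \<Longrightarrow> f i x \<in> V"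
    and invol: "i < n \<Longrightarrow> x \<in> V \<Longrightarrow> f i (f i x) = x"
    and no_fix: "i < n \<Longrightarrow> x \<in> V \<Longrightarrow> f i x \<noteq> x"
    and disjoint: "i < n \<Longrightarrow> j < n \<Longrightarrow> i \<noteq> j \<Longrightarrow> x \<in> V \<Longrightarrow> f i x \<noteq> f j x"
    and transitive: "i < n \<Longrightarrow> j < n \<Longrightarrow> i \<noteq> j \<Longrightarrow> S \<subseteq> V \<Longrightarrow> S \<noteq> {} \<Longrightarrow>
      f i ` S \<subseteq> S \<Longrightarrow> f j ` S \<subseteq> S \<Longrightarrow> S = V"
begin

text \<open>Two factors together form a Hamiltonian cycle, which deleting \<open>w\<close> opens
  into a path. In each factor the deletion leaves only \<open>f i w\<close> without a partner; this
  gives the bound on the size. The bijection \<open>h\<close> renames the remaining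
  vertices.\<close>

lemma near_matchings:
  "\<exists>M. (\<forall>i<n. M i \<subseteq> all_edges n \<and> pairwise disjnt (M i) \<and> n - 1 \<le> 2 * card (M i)) \<and>
    (\<forall>i<n. \<forall>j<n. i \<noteq> j \<longrightarrow> M i \<inter> M j = {} \<and>
      (\<exists>x. bij_betw x {..<n} {1..n} \<and> (\<forall>k. Suc k < n \<longrightarrow> {x k, x (Suc k)} \<in> M i \<union> M j)))"
proof -
  have finV: "finite V" using card_V by (metis card.infinite nat.distinct(1))
  obtain w where w: "w \<in> V" using card_V by fastforce
  have "card (V - {w}) = card {1..n}" using card_V w finV by simp
  then obtain h where h: "bij_betw h (V - {w}) {1..n}"
    using finV by (metis finite_Diff finite_atLeastAtMost finite_same_card_bij)
  define M where "M i = {{h x, h (f i x)} | x. x \<in> V - {w} \<and> f i x \<noteq> w}" for i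
  have hinj: "h x = h y \<longleftrightarrow> x = y" if "x \<in> V - {w}" "y \<in> V - {w}" for x y
    using h that by (auto simp: bij_betw_def dest: inj_onD)
  have hmem: "h x \<in> {1..n}" if "x \<in> V - {w}" for x using h that by (auto simp: bij_betw_def)
  have M_E: "\<exists>x. e = {h x, h (f i x)} \<and> x \<in> V - {w} \<and> f i x \<in> V - {w}"
    if e: "e \<in> M i" and i: "i < n" for e i
  proof -
    obtain x where "e = {h x, h (f i x)}" "x \<in> V - {w}" "f i x \<noteq> w"
      using e unfolding M_def mem_Collect_eq by (elim exE conjE)
    then show ?thesis using closed[OF i, of x] by (intro exI[of _ x]) simp
  qed
  have edge: "y = f i x"
    if e: "{h x, h y} \<in> M i" and i: "i < n" and xy: "x \<in> V - {w}" "y \<in> V - {w}" for i x y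
  proof -
    obtain z where z: "{h x, h y} = {h z, h (f i z)}" "z \<in> V - {w}" "f i z \<in> V - {w}"
      using M_E[OF e i] by (elim exE conjE)
    then have "h x = h z \<and> h y = h (f i z) \<or> h x = h (f i z) \<and> h y = h z"
      by (simp only: doubleton_eq_iff)
    then have "x = z \<and> y = f i z \<or> x = f i z \<and> y = z"
      using hinj[of x z] hinj[of y "f i z"] hinj[of x "f i z"] hinj[of y z] z(2,3) xy by simp
    then show ?thesis using invol[OF i, of z] z(2) by auto
  qed
  show ?thesis
  proof (intro exI[of _ M] conjI allI impI)
    fix i assume i: "i < n"
    show "M i \<subseteq> all_edges n"
    proof
      fix e assume "e \<in> M i"
      then obtain x where x: "e = {h x, h (f i x)}" "x \<in> V - {w}" "f i x \<in> V - {w}"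
        using M_E[OF _ i] by auto
      then have "h x \<noteq> h (f i x)" using hinj no_fix[OF i, of x] by auto
      then show "e \<in> all_edges n" using x hmem[of x] hmem[of "f i x"] by (auto simp: all_edges_def)
    qed
    show "pairwise disjnt (M i)"
    proof (rule pairwiseI)
      fix e e' assume ee: "e \<in> M i" "e' \<in> M i" "e \<noteq> e'"
      obtain x where x: "e = {h x, h (f i x)}" "x \<in> V - {w}" "f i x \<in> V - {w}"
        using M_E[OF ee(1) i] by auto
      obtain y where y: "e' = {h y, h (f i y)}" "y \<in> V - {w}" "f i y \<in> V - {w}"
        using M_E[OF ee(2) i] by auto
      have ix: "f i (f i x) = x" "f i (f i y) = y" using x y invol[OF i] by auto
      have "x \<noteq> y" "f i x \<noteq> y" using ee(3) x(1) y(1) ix by (auto simp: insert_commute)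
      moreover have "x \<noteq> f i y" "f i x \<noteq> f i y" using calculation ix by metis+
      ultimately show "disjnt e e'" using x y hinj by (auto simp: disjnt_def)
    qed
    show "n - 1 \<le> 2 * card (M i)"
    proof -
      have finM: "finite (M i)" using \<open>M i \<subseteq> all_edges n\<close> finite_all_edges finite_subset by blast
      have "h ` (V - {w, f i w}) \<subseteq> \<Union> (M i)"
      proof
        fix u assume "u \<in> h ` (V - {w, f i w})"
        then obtain x where x: "u = h x" "x \<in> V - {w}" "x \<noteq> f i w" by auto
        then have "f i x \<noteq> w" using invol[OF i, of x] by auto
        then have "{h x, h (f i x)} \<in> M i" using x by (auto simp: M_def)
        then show "u \<in> \<Union> (M i)" using x(1) by blast
      qed
      moreover have "finite (\<Union> (M i))"
        using finM M_E[OF _ i] by (auto dest!: M_E[OF _ i])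
      ultimately have "card (h ` (V - {w, f i w})) \<le> card (\<Union> (M i))" by (rule card_mono[rotated])
      also have "\<dots> \<le> sum card (M i)" by (rule card_Union_le_sum_card)
      also have "\<dots> = (\<Sum>e\<in>M i. 2)"
        using \<open>M i \<subseteq> all_edges n\<close> by (intro sum.cong) (auto simp: all_edges_def)
      also have "card (h ` (V - {w, f i w})) = card (V - {w, f i w})"
        using h by (intro card_image) (auto simp: bij_betw_def intro: inj_on_subset)
      also have "\<dots> = n - 1"
        using w closed[OF i w] no_fix[OF i w] card_V finV by (subst card_Diff_subset) auto
      finally show ?thesis by simp
    qed
    fix j assume j: "j < n" "i \<noteq> j"
    show "M i \<inter> M j = {}"
    proof (rule ccontr)
      assume "M i \<inter> M j \<noteq> {}"
      then obtain e where e: "e \<in> M i" "e \<in> M j" by auto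
      then obtain x where x: "e = {h x, h (f i x)}" "x \<in> V - {w}" "f i x \<in> V - {w}"
        using M_E[OF _ i] by auto
      then have "f i x = f j x" using edge[of x "f i x" j] e(2) j by simp
      then show False using disjoint[OF i j] x by auto
    qed
    have f: "f k x \<in> V \<and> f k (f k x) = x \<and> f k x \<noteq> x" if "k < n" "x \<in> V" for k x
      using closed invol no_fix that by simp
    have tr: "S = V" if "S \<subseteq> V" "w \<in> S" "f i ` S \<subseteq> S" "f j ` S \<subseteq> S" for S
      using transitive[OF i j that(1) _ that(3,4)] that(2) by blast
    have "\<exists>z. bij_betw z {..<card V - 1} (V - {w}) \<and>
      (\<forall>k. Suc k < card V - 1 \<longrightarrow> z (Suc k) = f i (z k) \<or> z (Suc k) = f j (z k))"
      using finV w by (rule two_involutions_hamiltonian_path) (fact f[OF i] f[OF j(1)] tr)+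
    then obtain z where z: "bij_betw z {..<card V - 1} (V - {w})"
      "\<And>k. Suc k < card V - 1 \<Longrightarrow> z (Suc k) = f i (z k) \<or> z (Suc k) = f j (z k)"
      by auto
    have "bij_betw (h \<circ> z) {..<n} {1..n}"
      using bij_betw_trans[OF z(1) h] card_V by simp
    moreover have "{(h \<circ> z) k, (h \<circ> z) (Suc k)} \<in> M i \<union> M j" if "Suc k < n" for k
    proof -
      have "z k \<in> V - {w}" "z (Suc k) \<in> V - {w}"
        using z(1) that card_V by (auto simp: bij_betw_def)
      then show ?thesis using z(2)[of k] that card_V by (auto simp: M_def)
    qed
    ultimately show "\<exists>x. bij_betw x {..<n} {1..n} \<and>
        (\<forall>k. Suc k < n \<longrightarrow> {x k, x (Suc k)} \<in> M i \<union> M j)"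
      by blast
  qed
qed

text \<open>By the bound on \<open>n\<close>, \<open>d\<close> binary digits separate all indices.
  By the bound on \<open>k\<close>, a matching with at least \<open>(n - 1) / 2\<close> edges
  provides \<open>3 * k + 1\<close> edges for each digit position.\<close>

lemma M_F_leaves_ge:
  assumes n: "2 \<le> n" and d: "n \<le> 2 ^ d" and k: "2 * ((3 * k + 1) * d) \<le> n - 1"
  shows "2 ^ (n - 2) \<le> M_F (F_leaves (k + 2)) n"
proof -
  obtain M where
    "\<forall>i<n. M i \<subseteq> all_edges n \<and> pairwise disjnt (M i) \<and> n - 1 \<le> 2 * card (M i)"
    "\<forall>i<n. \<forall>j<n. i \<noteq> j \<longrightarrow> M i \<inter> M j = {} \<and>
      (\<exists>x. bij_betw x {..<n} {1..n} \<and> (\<forall>k. Suc k < n \<longrightarrow> {x k, x (Suc k)} \<in> M i \<union> M j))"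
    using near_matchings by auto
  then have M: "\<And>i. i < n \<Longrightarrow> M i \<subseteq> all_edges n"
    "\<And>i. i < n \<Longrightarrow> pairwise disjnt (M i)"
    "\<And>i. i < n \<Longrightarrow> n - 1 \<le> 2 * card (M i)"
    "\<And>i j. i < n \<Longrightarrow> j < n \<Longrightarrow> i \<noteq> j \<Longrightarrow> M i \<inter> M j = {}"
    "\<And>i j. i < n \<Longrightarrow> j < n \<Longrightarrow> i \<noteq> j \<Longrightarrow>
      \<exists>x. bij_betw x {..<n} {1..n} \<and> (\<forall>k. Suc k < n \<longrightarrow> {x k, x (Suc k)} \<in> M i \<union> M j)"
    by simp_all
  have d0: "0 < d" using n d by (cases d) auto
  have card_M: "(3 * k + 1) * d \<le> card (M i)" if "i < n" for i
    using M(3)[OF that] k by linarith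
  have card_M': "3 * k + 1 \<le> card (M i)" if "i < n" for i
    using card_M[OF that] d0 by (metis le_trans mult.right_neutral mult_le_mono2 Suc_leI One_nat_def)
  \<comment> \<open>The matching with the last index \<open>m\<close> is reserved; the
    \<open>m = Suc (n - 2)\<close> others have \<open>2 ^ (n - 2)\<close> even sets of
    indices.\<close>
  define m where "m = n - 1"
  have m: "m < n" "Suc (n - 2) = m" using n by (auto simp: m_def)
  have finM: "finite (M m)" using M(1)[OF m(1)] finite_all_edges finite_subset by blast
  then obtain r where r: "bij_betw r (M m) {..<card (M m)}"
    using ex_bij_betw_finite_nat by (metis atLeast0LessThan)
  \<comment> \<open>\<open>S e\<close> collects the indices that toggle the edge \<open>e\<close>:
    for an edge of another matching only its own index, for an edge of \<open>M m\<close> all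
    indices with digit 1 at position \<open>r e mod d\<close>. Counting modulo 2 makes
    \<open>\<Gamma>\<close> additive for symmetric differences.\<close>
  define S where "S e = {i. i < m \<and> (e \<in> M i \<or> e \<in> M m \<and> bit i (r e mod d))}" for e
  define \<Gamma> where "\<Gamma> A = {e \<in> all_edges n. odd (card (A \<inter> S e))}" for A
  have S_M: "S e = {i}" if "e \<in> M i" "i < m" for e i
  proof -
    have "j = i" if "j < n" "e \<in> M j" for j
      using M(4)[of i j] \<open>e \<in> M i\<close> \<open>i < m\<close> m(1) that by auto
    then have "e \<notin> M m" and "e \<in> M j \<longleftrightarrow> j = i" if "j < m" for j
      using \<open>e \<in> M i\<close> \<open>i < m\<close> m(1) that by force+
    then show ?thesis using that by (auto simp: S_def)
  qed
  have S_m: "S e = {i. i < m \<and> bit i (r e mod d)}" if "e \<in> M m" for e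
  proof -
    have "e \<notin> M i" if "i < m" for i using M(4)[of m i] \<open>e \<in> M m\<close> m(1) that by auto
    then show ?thesis using that by (auto simp: S_def)
  qed
  have M_\<Gamma>: "M i \<subseteq> \<Gamma> A" if "i \<in> A" "i < m" for i A
    using that M(1)[of i] m(1) S_M by (auto simp: \<Gamma>_def)
  have \<Gamma>_sym_diff: "sym_diff (\<Gamma> A) (\<Gamma> B) = \<Gamma> ((A - B) \<union> (B - A))"
    if "finite A" "finite B" for A B
  proof -
    have "(A - B \<union> (B - A)) \<inter> S e = (A \<inter> S e - B \<inter> S e) \<union> (B \<inter> S e - A \<inter> S e)" for e by auto
    then have "odd (card ((A - B \<union> (B - A)) \<inter> S e)) \<longleftrightarrow> odd (card (A \<inter> S e)) \<noteq> odd (card (B \<inter> S e))" for e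
      using even_card_sym_diff[of "A \<inter> S e" "B \<inter> S e"] that by auto
    then show ?thesis by (auto simp: \<Gamma>_def sym_diff_def)
  qed
  have tree: "F_leaves (k + 2) n (\<Gamma> A)" if A: "A \<subseteq> {..<m}" "even (card A)" "A \<noteq> {}" for A
  proof -
    obtain i where i: "i \<in> A" using A(3) by auto
    have "A \<noteq> {i}" using A(2) by auto
    then obtain j where j: "j \<in> A" "j \<noteq> i" using i by auto
    have lt: "i < m" "j < m" "i < n" "j < n" using i j A(1) m(1) by auto
    \<comment> \<open>\<open>M i\<close> and \<open>M j\<close> supply the path. The chords come
      from a third matching of \<open>A\<close> or, if there is none, from the edges of
      \<open>M m\<close> reading a digit in which \<open>i\<close> and \<open>j\<close>
      differ.\<close>
    obtain R where R: "R \<subseteq> \<Gamma> A" "R \<inter> (M i \<union> M j) = {}" "R \<subseteq> all_edges n" "pairwise disjnt R"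
      "3 * k + 1 \<le> card R"
    proof (cases "A = {i, j}")
      case False
      then obtain l where l: "l \<in> A" "l \<noteq> i" "l \<noteq> j" using i j by auto
      then have "l < m" "l < n" using A(1) m(1) by auto
      moreover have "M l \<inter> (M i \<union> M j) = {}" using M(4)[of l i] M(4)[of l j] l lt \<open>l < n\<close> by blast
      ultimately show ?thesis using that[OF M_\<Gamma>] M(1,2) card_M' l(1) by blast
    next
      case True
      obtain t where t: "t < d" "bit i t \<noteq> bit j t"
        using exists_distinguishing_bit[of i d j] lt d j(2) by auto
      define R where "R = {e \<in> M m. r e mod d = t}"
      have "odd (card (A \<inter> S e))" if "e \<in> R" for e
      proof -
        have "A \<inter> S e = (if bit i t then {i} else {j})"
          using True S_m[of e] that lt t(2) j(2) by (auto simp: R_def)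
        then show ?thesis by simp
      qed
      moreover have "R \<subseteq> M m" by (auto simp: R_def)
      ultimately have sub: "R \<subseteq> \<Gamma> A" using M(1)[OF m(1)] by (auto simp: \<Gamma>_def)
      have "r ` R = {q. q < card (M m) \<and> q mod d = t}"
      proof -
        have "r ` M m = {..<card (M m)}" using r by (simp add: bij_betw_def)
        then have "{q. q < card (M m) \<and> q mod d = t} = {q \<in> r ` M m. q mod d = t}" by auto
        then show ?thesis by (auto simp: R_def)
      qed
      moreover have "inj_on r R" using r \<open>R \<subseteq> M m\<close> by (auto simp: bij_betw_def intro: inj_on_subset)
      ultimately have "card R = card {q. q < card (M m) \<and> q mod d = t}" using card_image by metis
      also have "\<dots> \<ge> card (M m) div d" using t(1) by (rule card_residue_class_ge)
      finally have "card (M m) div d \<le> card R" .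
      moreover have "3 * k + 1 \<le> card (M m) div d"
        using card_M[OF m(1)] d0 by (simp add: less_eq_div_iff_mult_less_eq)
      ultimately have "3 * k + 1 \<le> card R" by linarith
      then show ?thesis
        using that[OF sub _ subset_trans[OF \<open>R \<subseteq> M m\<close> M(1)[OF m(1)]] pairwise_subset[OF M(2)[OF m(1)] \<open>R \<subseteq> M m\<close>]]
          \<open>R \<subseteq> M m\<close> M(4)[of m i] M(4)[of m j] m(1) lt by blast
    qed
    obtain x where x: "bij_betw x {..<n} {1..n}" "\<And>k. Suc k < n \<Longrightarrow> {x k, x (Suc k)} \<in> M i \<union> M j"
      using M(5)[OF lt(3,4)] j(2) by metis
    show ?thesis
    proof (rule F_leaves_path_matching[OF x(1) n _ R(1,3,4,5)])
      show "{x k, x (Suc k)} \<in> \<Gamma> A - R" if "Suc k < n" for k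
        using x(2)[OF that] R(2) M_\<Gamma>[OF i lt(1)] M_\<Gamma>[OF j(1) lt(2)] by auto
    qed
  qed
  have "2 ^ (n - 2) \<le> card {A. A \<subseteq> {..<m} \<and> even (card A)}"
    using card_even_subsets_ge[of "n - 2"] m(2) by simp
  also have "\<dots> \<le> M_F (F_leaves (k + 2)) n"
  proof (rule M_F_ge_card[where \<Gamma> = \<Gamma>])
    show "is_graph n (\<Gamma> A)" for A by (auto simp: is_graph_def \<Gamma>_def)
    show "\<not> F_leaves (k + 2) n {}" using n by (auto simp: F_leaves_def is_spanning_tree_on_def)
    fix A B assume "A \<in> {A. A \<subseteq> {..<m} \<and> even (card A)}" "B \<in> {A. A \<subseteq> {..<m} \<and> even (card A)}" "A \<noteq> B"
    then have "finite A" "finite B" "(A - B) \<union> (B - A) \<subseteq> {..<m}" "(A - B) \<union> (B - A) \<noteq> {}"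
      "even (card A)" "even (card B)"
      using finite_subset[of _ "{..<m}"] by auto
    then show "F_leaves (k + 2) n (sym_diff (\<Gamma> A) (\<Gamma> B))"
      using \<Gamma>_sym_diff[of A B] tree[of "(A - B) \<union> (B - A)"] even_card_sym_diff[of A B] by metis
  qed
  finally show ?thesis .
qed

lemma good_n:
  assumes "64 \<le> n"
  shows "good_n n"
  unfolding good_n_def
proof (intro allI impI, elim conjE)
  fix l :: nat assume l: "3 \<le> l" "real l \<le> (real n - 1) / (12 * log 2 (real n)) + 2"
  define k where "k = l - 2"
  have k: "l = k + 2" "1 \<le> k" using l(1) by (auto simp: k_def)
  define y where "y = log 2 (real n)"
  have "log 2 64 \<le> y" unfolding y_def using assms by (subst log_le_cancel_iff) auto
  moreover have "log 2 64 = (6 :: real)" using log_pow_cancel[of "2 :: real" 6] by simp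
  ultimately have y6: "6 \<le> y" by simp
  define d where "d = nat \<lceil>y\<rceil>"
  have dy: "y \<le> real d" "real d \<le> y + 1" unfolding d_def using y6 by linarith+
  have "real n = 2 powr y" unfolding y_def using assms by simp
  also have "\<dots> \<le> 2 powr real d" using dy by simp
  also have "\<dots> = real (2 ^ d)" by (simp add: powr_realpow)
  finally have nd: "n \<le> 2 ^ d" by (simp only: of_nat_le_iff)
  have "real k \<le> (real n - 1) / (12 * y)" using l(2) k by (simp add: y_def)
  then have ky: "12 * (real k * y) \<le> real n - 1" using y6 by (simp add: field_simps)
  \<comment> \<open>Here \<open>3 * k + 1 \<le> 4 * k\<close> and
    \<open>d \<le> y + 1 \<le> 3 / 2 * y\<close>; twice the product of the bounds is
    \<open>12 * k * y\<close>, the source of the constant 12.\<close>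
  have "(3 * real k + 1) * real d \<le> (4 * real k) * (3 / 2 * y)"
    using k(2) dy y6 by (intro mult_mono) auto
  then have "2 * ((3 * real k + 1) * real d) \<le> real n - 1" using ky by (simp add: algebra_simps)
  then have "real (2 * ((3 * k + 1) * d)) \<le> real (n - 1)" using assms by (simp add: of_nat_diff algebra_simps)
  then have "2 * ((3 * k + 1) * d) \<le> n - 1" by (simp only: of_nat_le_iff)
  then show "2 ^ (n - 2) \<le> M_F (F_leaves l) n"
    using M_F_leaves_ge[OF _ nd] assms k(1) by simp
qed

end

section \<open>Factorizations from an odd prime\<close>

text \<open>As \<open>d\<close> is invertible modulo \<open>p\<close>, its multiples lead from any
  residue to every other.\<close>

lemma residues_closed_under_translation:
  fixes p d :: int
  assumes p: "prime p" and d: "\<not> p dvd d"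
    and S: "S \<subseteq> {0..<p}" "S \<noteq> {}" "\<And>x. x \<in> S \<Longrightarrow> (x + d) mod p \<in> S"
  shows "S = {0..<p}"
proof -
  obtain u where u: "u \<in> S" using S(2) by auto
  have orbit: "(u + int k * d) mod p \<in> S" for k
  proof (induction k)
    case 0
    then show ?case using S(1) u by auto
  next
    case (Suc k)
    have "((u + int k * d) mod p + d) mod p = (u + int (Suc k) * d) mod p"
      by (simp add: mod_simps algebra_simps)
    then show ?case using S(3)[OF Suc] by simp
  qed
  have "coprime d p" using p d by (metis prime_imp_coprime coprime_commute)
  then obtain c where c: "[d * c = 1] (mod p)" using cong_solve_coprime_int by blast
  have "y \<in> S" if y: "y \<in> {0..<p}" for y
  proof -
    define k where "k = nat ((c * (y - u)) mod p)"
    have "int k = (c * (y - u)) mod p" using p by (simp add: k_def prime_gt_0_int)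
    then have "[int k = c * (y - u)] (mod p)" by (simp add: cong_def)
    then have "[u + int k * d = u + c * (y - u) * d] (mod p)" by (intro cong_add cong_mult) auto
    also have "u + c * (y - u) * d = u + (y - u) * (d * c)" by simp
    also have "[\<dots> = u + (y - u) * 1] (mod p)" using c by (intro cong_add cong_mult) auto
    finally have "(u + int k * d) mod p = y" using y by (simp add: cong_def)
    then show ?thesis using orbit[of k] by simp
  qed
  then show ?thesis using S(1) by auto
qed

locale odd_prime =
  fixes p :: nat
  assumes prime_p: "prime p" and odd_p: "odd p"
begin

text \<open>Division by 2 modulo \<open>p\<close>: \<open>(p + 1) div 2\<close> is the inverse of
  2.\<close>

definition half :: "int \<Rightarrow> int" where
  "half s = (s * ((int p + 1) div 2)) mod int p"

lemma p_pos: "0 < int p"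
  using prime_p by (simp add: prime_gt_0_nat)

lemma half_range: "half s \<in> {0..<int p}"
  using p_pos by (simp add: half_def)

lemma two_half: "(2 * half s) mod int p = s mod int p"
proof -
  have "2 * ((int p + 1) div 2) = int p + 1" using odd_p by (intro dvd_mult_div_cancel) simp
  then have "2 * (s * ((int p + 1) div 2)) = s + s * int p" by (simp add: algebra_simps)
  then show ?thesis by (simp add: half_def mod_simps)
qed

lemma dvd_small: "int p dvd x - y \<Longrightarrow> x \<in> {0..<int p} \<Longrightarrow> y \<in> {0..<int p} \<Longrightarrow> x = y"
  by (metis mod_eq_dvd_iff atLeastLessThan_iff mod_pos_pos_trivial)

lemma half_inj: "half s = half t \<Longrightarrow> s \<in> {0..<int p} \<Longrightarrow> t \<in> {0..<int p} \<Longrightarrow> s = t"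
  by (metis two_half atLeastLessThan_iff mod_pos_pos_trivial)

text \<open>A fixed point solves \<open>2 * x = s\<close> modulo \<open>p\<close>, and 2 can be
  cancelled because \<open>p\<close> is odd.\<close>

lemma reflection_fixed_iff:
  assumes "x \<in> {0..<int p}"
  shows "(s - x) mod int p = x \<longleftrightarrow> x = half s"
proof
  assume "(s - x) mod int p = x"
  then have "(s - x) mod int p = x mod int p" using assms by simp
  then have "int p dvd s - 2 * x" by (simp add: mod_eq_dvd_iff algebra_simps)
  moreover have "int p dvd 2 * half s - s" using two_half by (simp add: mod_eq_dvd_iff)
  ultimately have "int p dvd 2 * (half s - x)"
    using dvd_add[of "int p" "s - 2 * x" "2 * half s - s"] by (simp add: algebra_simps)
  moreover have "coprime (int p) 2" using odd_p by simp
  ultimately have "int p dvd half s - x" using coprime_dvd_mult_right_iff by blast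
  then show "x = half s" using dvd_small half_range assms by blast
next
  assume "x = half s"
  moreover have "int p dvd s - 2 * half s" using two_half by (metis mod_eq_dvd_iff)
  ultimately have "(s - x) mod int p = x mod int p" by (simp add: mod_eq_dvd_iff algebra_simps)
  then show "(s - x) mod int p = x" using assms by simp
qed

text \<open>Turns closure under two reflections into closure under a translation; for
  \<open>s = t\<close> it shows that a reflection is an involution.\<close>

lemma reflection_reflection:
  "(t - (s - x) mod int p) mod int p = (x + (t - s)) mod int p"
  by (simp add: mod_simps algebra_simps)

lemma not_dvd_diff: "s \<in> {0..<int p} \<Longrightarrow> t \<in> {0..<int p} \<Longrightarrow> s \<noteq> t \<Longrightarrow> \<not> int p dvd t - s"
  using dvd_small by blast

text \<open>The vertex \<open>p\<close>, outside the residues \<open>0, \<dots>, p - 1\<close>, plays the role of infinity.\<close>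

definition reflect :: "nat \<Rightarrow> int \<Rightarrow> int" where
  "reflect i x = (if x = int p then half (int i)
     else if x = half (int i) then int p else (int i - x) mod int p)"

text \<open>Distinct residues \<open>x\<close> and \<open>y\<close> are joined in the factor
  \<open>x + y\<close> modulo \<open>p\<close>. Two factors compose to a translation by
  \<open>j - i\<close>, which is not 0 modulo \<open>p\<close>, so an invariant set contains all
  residues, and \<open>half i\<close> leads on to infinity.\<close>

lemma perfect_factorization_prime: "perfect_factorization p {0..int p} reflect"
proof
  show "card {0..int p} = Suc p" by simp
next
  fix i x assume i: "i < p" and x: "x \<in> {0..int p}"
  have h: "half (int i) \<in> {0..<int p}" by (rule half_range)
  have xr: "x \<noteq> int p \<Longrightarrow> x \<in> {0..<int p}" using x by auto
  have r: "(int i - x) mod int p \<in> {0..<int p}" using p_pos by simp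
  show "reflect i x \<in> {0..int p}"
    using h p_pos by (auto simp: reflect_def less_imp_le[OF pos_mod_bound])
  show "reflect i x \<noteq> x"
    using h xr reflection_fixed_iff[of x "int i"] by (auto simp: reflect_def)
  show "reflect i (reflect i x) = x"
  proof (cases "x = int p \<or> x = half (int i)")
    case True
    then show ?thesis using h by (auto simp: reflect_def)
  next
    case False
    have rr: "(int i - (int i - x) mod int p) mod int p = x"
      using reflection_reflection[of "int i" "int i" x] xr False by simp
    then have "(int i - x) mod int p \<noteq> half (int i)"
      using reflection_fixed_iff[OF r, of "int i"] reflection_fixed_iff[of x "int i"] xr False by auto
    then show ?thesis using False r rr by (auto simp: reflect_def)
  qed
  fix j assume j: "j < p" "i \<noteq> j"
  have "half (int i) \<noteq> half (int j)" using half_inj[of "int i" "int j"] i j by auto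
  moreover have "(int i - x) mod int p \<noteq> (int j - x) mod int p"
    using not_dvd_diff[of "int j" "int i"] i j by (auto simp: mod_eq_dvd_iff)
  moreover have "(int k - x) mod int p \<noteq> int p" for k using p_pos by (simp add: less_imp_neq)
  ultimately show "reflect i x \<noteq> reflect j x" unfolding reflect_def by metis
next
  fix i j S
  assume ij: "i < p" "j < p" "i \<noteq> j" and S: "S \<subseteq> {0..int p}" "S \<noteq> {}"
    and cl: "reflect i ` S \<subseteq> S" "reflect j ` S \<subseteq> S"
  \<comment> \<open>The point that \<open>reflect k\<close> sends to infinity is fixed by the plain
    reflection, so it causes no exception here.\<close>
  have refl: "(int k - x) mod int p \<in> S" if "x \<in> S" "x \<noteq> int p" "k = i \<or> k = j" for k x
  proof (cases "x = half (int k)")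
    case True
    then show ?thesis using reflection_fixed_iff[of x "int k"] half_range that(1) by simp
  next
    case False
    then have "reflect k x = (int k - x) mod int p" using that by (simp add: reflect_def)
    then show ?thesis using cl that by (metis image_subset_iff)
  qed
  obtain x where x: "x \<in> S" using S(2) by auto
  have half_mem: "half (int i) \<in> S" if "int p \<in> S"
    using cl(1) that by (force simp: reflect_def)
  have "S \<inter> {0..<int p} = {0..<int p}"
  proof (rule residues_closed_under_translation)
    show "\<not> int p dvd int j - int i" using not_dvd_diff[of "int i" "int j"] ij by auto
    show "S \<inter> {0..<int p} \<noteq> {}"
    proof (cases "x = int p")
      case True
      then show ?thesis using x half_mem half_range by blast
    next
      case False
      then have "x \<in> {0..<int p}" using x S(1) by force
      then show ?thesis using x by blast
    qed
    fix y assume y: "y \<in> S \<inter> {0..<int p}"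
    then have "(int j - (int i - y) mod int p) mod int p \<in> S"
      using p_pos by (intro refl) (auto simp: less_imp_neq)
    then show "(y + (int j - int i)) mod int p \<in> S \<inter> {0..<int p}"
      using p_pos by (simp add: reflection_reflection)
  qed (use prime_p in auto)
  then have sub: "{0..<int p} \<subseteq> S" by auto
  then have "reflect i (half (int i)) \<in> S" using half_range cl(1) by blast
  then have "int p \<in> S" using half_range[of "int i"] by (auto simp: reflect_def split: if_splits)
  moreover have "{0..int p} = insert (int p) {0..<int p}" using p_pos by auto
  ultimately show "S = {0..int p}" using sub S(1) by auto
qed

text \<open>The factors \<open>i < p\<close> reflect both copies of the residues and join the two fixed points; the
  factor \<open>p + t - 1\<close> with \<open>0 < t < p\<close> is the shift by \<open>t\<close> between the copies. The shift by
  \<open>0\<close> is missing because its edges are those between the fixed points.\<close>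

definition double_reflect :: "nat \<Rightarrow> int \<times> bool \<Rightarrow> int \<times> bool" where
  "double_reflect i = (\<lambda>(x, b).
     if i < p then if x = half (int i) then (x, \<not> b) else ((int i - x) mod int p, b)
     else ((if b then x - (int i - int p + 1) else x + (int i - int p + 1)) mod int p, \<not> b))"

text \<open>In each case a composite of the two maps translates a copy of the residues by a nonzero
  amount: by \<open>j - i\<close> for two reflections, by \<open>2 * t\<close> for a reflection and
  the shift by \<open>t\<close>, and by the difference of two shifts. A shift, or the edge between
  the fixed points, then reaches the other copy.\<close>

lemma double_reflect_transitive:
  assumes ij: "i < j" "j < 2 * p - 1" and S: "S \<subseteq> {0..<int p} \<times> UNIV" "S \<noteq> {}"
    and cl: "double_reflect i ` S \<subseteq> S" "double_reflect j ` S \<subseteq> S"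
  shows "S = {0..<int p} \<times> UNIV"
proof -
  define L where "L b = {x. (x, b) \<in> S}" for b
  have L_sub: "L b \<subseteq> {0..<int p}" for b using S(1) by (auto simp: L_def)
  have mem: "double_reflect k (x, b) \<in> S" if "x \<in> L b" "k = i \<or> k = j" for k x b
    using cl that by (auto simp: L_def)
  have refl: "(int k - x) mod int p \<in> L b" if "x \<in> L b" "k = i \<or> k = j" "k < p" for k x b
  proof (cases "x = half (int k)")
    case True
    then show ?thesis using reflection_fixed_iff[of x "int k"] half_range that(1) by simp
  next
    case False
    then show ?thesis using mem[OF that(1,2)] that(3) by (simp add: double_reflect_def L_def)
  qed
  have up: "(x + (int k - int p + 1)) mod int p \<in> L True" if "x \<in> L False" "k = i \<or> k = j" "p \<le> k" for k x
    using mem[OF that(1,2)] that(3) by (simp add: double_reflect_def L_def)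
  have down: "(x - (int k - int p + 1)) mod int p \<in> L False" if "x \<in> L True" "k = i \<or> k = j" "p \<le> k" for k x
    using mem[OF that(1,2)] that(3) by (simp add: double_reflect_def L_def)
  obtain x c where xc: "x \<in> L c" using S(2) by (auto simp: L_def)
  have full: "L b = {0..<int p}" for b
  proof (cases "j < p")
    case True
    have full_if: "L b = {0..<int p}" if "L b \<noteq> {}" for b
    proof (rule residues_closed_under_translation)
      show "\<not> int p dvd int j - int i"
        using not_dvd_diff[of "int i" "int j"] ij(1) True by auto
      show "(y + (int j - int i)) mod int p \<in> L b" if "y \<in> L b" for y
        using refl[of "(int i - y) mod int p" b j] refl[of y b i] that True ij(1)
        by (simp add: reflection_reflection)
    qed (use L_sub that prime_p in auto)
    have "half (int i) \<in> L c" using full_if[of c] xc half_range by (metis empty_iff)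
    then have "half (int i) \<in> L (\<not> c)"
      using mem[of "half (int i)" c i] ij(1) True by (simp add: double_reflect_def L_def)
    then show ?thesis using full_if[of c] full_if[of "\<not> c"] xc by (cases b; cases c) auto
  next
    case False
    define t where "t = int j - int p + 1"
    have t: "0 < t" "t < int p" using False ij(2) by (auto simp: t_def)
    have up_j: "(x + t) mod int p \<in> L True" if "x \<in> L False" for x
      using up[of x j] that False by (simp add: t_def)
    have down_j: "(x - t) mod int p \<in> L False" if "x \<in> L True" for x
      using down[of x j] that False by (simp add: t_def)
    have ne: "L False \<noteq> {}" using xc down_j by (cases c) auto
    have F: "L False = {0..<int p}"
    proof (cases "i < p")
      case True
      show ?thesis
      proof (rule residues_closed_under_translation[where d = "2 * t"])
        show "\<not> int p dvd 2 * t"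
          using t odd_p by (metis coprime_dvd_mult_right_iff coprime_right_2_iff_odd even_of_nat zdvd_not_zless)
        fix y assume "y \<in> L False"
        \<comment> \<open>Shift up, reflect, shift down, reflect: \<open>y\<close>,
          \<open>y + t\<close>, \<open>i - y - t\<close>, \<open>i - y - 2 * t\<close>,
          \<open>y + 2 * t\<close>.\<close>
        then have "(int i - ((int i - (y + t) mod int p) mod int p - t) mod int p) mod int p \<in> L False"
          using True by (intro refl down_j up_j) auto
        then show "(y + 2 * t) mod int p \<in> L False" by (simp add: mod_simps algebra_simps)
      qed (use L_sub ne prime_p in auto)
    next
      case i: False
      show ?thesis
      proof (rule residues_closed_under_translation[where d = "t - (int i - int p + 1)"])
        show "\<not> int p dvd t - (int i - int p + 1)"
          using ij t i not_dvd_diff[of "int i - int p + 1" t] by (auto simp: t_def)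
        fix y assume "y \<in> L False"
        then have "((y + t) mod int p - (int i - int p + 1)) mod int p \<in> L False"
          using i by (intro down up_j) auto
        then show "(y + (t - (int i - int p + 1))) mod int p \<in> L False"
          by (simp only: mod_diff_left_eq add_diff_eq)
      qed (use L_sub ne prime_p in auto)
    qed
    have "y \<in> L True" if "y \<in> {0..<int p}" for y
    proof -
      have "(y - t) mod int p \<in> L False" using F p_pos by simp
      from up_j[OF this] show ?thesis using that by (simp add: mod_simps)
    qed
    then have "L True = {0..<int p}" using L_sub by blast
    then show ?thesis using F by (cases b) auto
  qed
  show ?thesis
  proof
    show "{0..<int p} \<times> UNIV \<subseteq> S"
    proof clarify
      fix x b assume "x \<in> {0..<int p}"
      then show "(x, b) \<in> S" using full[of b] by (auto simp: L_def)
    qed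
  qed (rule S(1))
qed

lemma perfect_factorization_double_prime:
  "perfect_factorization (2 * p - 1) ({0..<int p} \<times> UNIV) double_reflect"
proof
  show "card ({0..<int p} \<times> (UNIV :: bool set)) = Suc (2 * p - 1)"
    using p_pos by (simp add: card_cartesian_product)
next
  fix i and z :: "int \<times> bool" assume i: "i < 2 * p - 1" and z: "z \<in> {0..<int p} \<times> UNIV"
  obtain x b where xb: "z = (x, b)" by fastforce
  have x: "x \<in> {0..<int p}" using z xb by simp
  have r: "(int k - x) mod int p \<in> {0..<int p}" for k using p_pos by simp
  show "double_reflect i z \<in> {0..<int p} \<times> UNIV"
    using p_pos x by (simp add: xb double_reflect_def)
  show "double_reflect i z \<noteq> z"
    using reflection_fixed_iff[OF x, of "int i"] by (simp add: xb double_reflect_def)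
  show "double_reflect i (double_reflect i z) = z"
  proof (cases "i < p")
    case True
    have rr: "(int i - (int i - x) mod int p) mod int p = x"
      using reflection_reflection[of "int i" "int i" x] x by simp
    then have "x \<noteq> half (int i) \<Longrightarrow> (int i - x) mod int p \<noteq> half (int i)"
      using reflection_fixed_iff[OF r, of "int i" i] reflection_fixed_iff[OF x, of "int i"] by auto
    then show ?thesis using True rr by (simp add: xb double_reflect_def)
  next
    case False
    then show ?thesis using x by (simp add: xb double_reflect_def mod_simps)
  qed
  fix j assume j: "j < 2 * p - 1" "i \<noteq> j"
  have less: "double_reflect i z \<noteq> double_reflect j z" if "i < j" "j < 2 * p - 1" for i j
  proof (cases "j < p")
    case True
    have "half (int i) \<noteq> half (int j)" using half_inj[of "int i" "int j"] that True by auto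
    moreover have "(int i - x) mod int p \<noteq> (int j - x) mod int p"
      using not_dvd_diff[of "int j" "int i"] that True by (auto simp: mod_eq_dvd_iff)
    ultimately show ?thesis using True that by (auto simp: xb double_reflect_def)
  next
    case False
    define t where "t = int j - int p + 1"
    have t: "0 < t" "t < int p" using False that by (auto simp: t_def)
    show ?thesis
    proof (cases "i < p")
      \<comment> \<open>A reflection changes the copy only at its fixed point, where it keeps the
        residue, whereas a nonzero shift changes both.\<close>
      case True
      have "\<not> int p dvd t" using t zdvd_not_zless by blast
      then have "(x + t) mod int p \<noteq> x mod int p" "(x - t) mod int p \<noteq> x mod int p"
        by (simp_all add: mod_eq_dvd_iff)
      then show ?thesis using True False x by (auto simp: xb double_reflect_def t_def)
    next
      case i: False
      define s where "s = int i - int p + 1"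
      have "\<not> int p dvd t - s" "\<not> int p dvd s - t"
        using not_dvd_diff[of s t] not_dvd_diff[of t s] t i that by (auto simp: s_def t_def)
      then have "(x + s) mod int p \<noteq> (x + t) mod int p" "(x - s) mod int p \<noteq> (x - t) mod int p"
        by (simp_all add: mod_eq_dvd_iff)
      then show ?thesis using False i by (auto simp: xb double_reflect_def s_def t_def)
    qed
  qed
  show "double_reflect i z \<noteq> double_reflect j z"
    using less[of i j] less[of j i] i j by (cases i j rule: linorder_cases) auto
next
  fix i j S
  assume "i < 2 * p - 1" "j < 2 * p - 1" "i \<noteq> j" "S \<subseteq> {0..<int p} \<times> UNIV" "S \<noteq> {}"
    "double_reflect i ` S \<subseteq> S" "double_reflect j ` S \<subseteq> S"
  then show "S = {0..<int p} \<times> UNIV"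
    using double_reflect_transitive[of i j S] double_reflect_transitive[of j i S]
    by (cases i j rule: linorder_cases) auto
qed

end

theorem theorem1p2:
  shows "infinite {n::nat. n > 0 \<and> good_n n} \<and>
    (\<forall>n p::nat. n \<ge> 64 \<and> prime p \<and> odd p \<and> (n = p \<or> n = 2 * p - 1) \<longrightarrow> good_n n)"
proof
  show good: "\<forall>n p::nat. n \<ge> 64 \<and> prime p \<and> odd p \<and> (n = p \<or> n = 2 * p - 1) \<longrightarrow> good_n n"
  proof (intro allI impI, elim conjE)
    fix n p :: nat assume n: "64 \<le> n" "n = p \<or> n = 2 * p - 1" and "prime p" "odd p"
    then interpret odd_prime p by unfold_locales
    show "good_n n"
      using n perfect_factorization.good_n[OF perfect_factorization_prime]
        perfect_factorization.good_n[OF perfect_factorization_double_prime] by auto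
  qed
  show "infinite {n::nat. n > 0 \<and> good_n n}"
  proof
    assume fin: "finite {n::nat. n > 0 \<and> good_n n}"
    have "p < 64 \<or> p \<in> {n. n > 0 \<and> good_n n}" if "prime p" for p :: nat
      using good[rule_format, of p p] that prime_odd_nat[of p] by (cases "p < 64") auto
    then have "{p::nat. prime p} \<subseteq> {..<64} \<union> {n. n > 0 \<and> good_n n}" by auto
    then have "finite {p::nat. prime p}" by (rule finite_subset) (use fin in simp)
    then show False using primes_infinite by simp
  qed
qed

end
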